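(* Let $f(X)=a_0+a_1X+\cdots+a_nX^n$ be a polynomial with integer coefficients, and assume that for two integers $a,b$ we have $0<|f(a)|<|f(b)|$. Let $$q=\max\left\{\frac{d_2}{d_1}\le\sqrt{\frac{|f(b)|}{|f(a)|}}\;:\; d_1\in\mathcal{D}_{ad}(f(a)),\ d_2\in\mathcal{D}_{ad}(f(b))\right\}.$$ Then: (i) If $q>1$ and all the (complex) roots of $f$ lie inside the Apollonius circle $\mathrm{Ap}(a,b,q)$, then $f$ is irreducible over $\mathbb{Q}$. (ii) If $q>1$, all the roots of $f$ lie inside the Apollonius circle $\mathrm{Ap}(a,b,\sqrt q)$ and $f$ has no rational roots, then $f$ is irreducible over $\mathbb{Q}$. (iii) Assume that $q=1$. If $b>a$ and all the roots of $f$ lie in the half-plane $\operatorname{Re} z<\frac{a+b}{2}$, or if $a>b$ and all the roots of $f$ lie in the half-plane $\operatorname{Re} z>\frac{a+b}{2}$, then $f$ is irreducible over $\mathbb{Q}$.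
   Context: Admissible divisors: for a non-constant polynomial $f\in\mathbb{Z}[X]$ and an integer $a$ with $f(a)\neq 0$, an integer $d$ is an admissible divisor of $f(a)$ if $d\mid f(a)$ and $\gcd\left(d,\frac{f(a)}{d}\right)\mid\gcd(f(a),f'(a))$, where $f'$ is the derivative of $f$. The set of all admissible divisors of $f(a)$ is denoted $\mathcal{D}_{ad}(f(a))$ (it depends on $f$ and $a$, not only on the integer $f(a)$). Apollonius circle: for real $a\ne b$ and $k>0$, $k\neq 1$, $\mathrm{Ap}(a,b,k)$ is the set of points $z=x+iy$ of the complex plane with $|z-b|=k|z-a|$, i.e. the circle $\left(x-a+\frac{b-a}{k^2-1}\right)^2+y^2=k^2\left(\frac{b-a}{k^2-1}\right)^2$. "Inside" means in the open disk bounded by this circle; for $k>1$ this disk is $\{z\in\mathbb{C}:|z-b|>k|z-a|\}$. *)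

theory Defs
  imports "HOL-Analysis.Analysis" "HOL-Computational_Algebra.Computational_Algebra"
begin

text \<open>
  The set depends on the polynomial \<open>f\<close> and the point \<open>a\<close>, not only on the integer \<open>poly f a\<close>.
  It is meaningful for nonconstant \<open>f\<close> with \<open>poly f a \<noteq> 0\<close>. Negative divisors are included.
\<close>

definition admissible_divisors :: "int poly \<Rightarrow> int \<Rightarrow> int set" where
  "admissible_divisors f a =
     {d. d dvd poly f a \<and>
         gcd d (poly f a div d) dvd gcd (poly f a) (poly (pderiv f) a)}"

lemma finite_admissible_divisors:
  assumes "poly f a \<noteq> 0"
  shows "finite (admissible_divisors f a)"
  by (rule finite_subset[OF _ finite_divisors_int[OF assms]])
     (auto simp: admissible_divisors_def)

lemma one_in_admissible_divisors: "1 \<in> admissible_divisors f a"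
  by (simp add: admissible_divisors_def)

lemma finite_admissible_quotients:
  assumes "poly f a \<noteq> 0" "poly f b \<noteq> 0"
  shows "finite {real_of_int d2 / real_of_int d1 | d1 d2.
           d1 \<in> admissible_divisors f a \<and> d2 \<in> admissible_divisors f b \<and>
           real_of_int d2 / real_of_int d1 \<le> t}"
  by (rule finite_subset[where B = "(\<lambda>(d1, d2). real_of_int d2 / real_of_int d1) `
             (admissible_divisors f a \<times> admissible_divisors f b)"])
     (use assms in \<open>auto intro!: finite_admissible_divisors\<close>)

lemma one_in_admissible_quotients:
  assumes "1 \<le> t"
  shows "1 \<in> {real_of_int d2 / real_of_int d1 | d1 d2.
           d1 \<in> admissible_divisors f a \<and> d2 \<in> admissible_divisors f b \<and>
           real_of_int d2 / real_of_int d1 \<le> t}"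
  using assms one_in_admissible_divisors[of f a] one_in_admissible_divisors[of f b]
  by (auto intro!: exI[where x = "1::int"])

text \<open>A circle only for \<open>a \<noteq> b\<close>, \<open>k > 0\<close> and \<open>k \<noteq> 1\<close>.\<close>

definition apollonius_circle :: "real \<Rightarrow> real \<Rightarrow> real \<Rightarrow> complex set" where
  "apollonius_circle a b k = {z. cmod (z - of_real b) = k * cmod (z - of_real a)}"

text \<open>
  The open disk bounded by the circle is rendered with the library's \<^const>\<open>inside\<close>. The following
  lemmas relate it to the centre and radius, and to the inequality \<open>|z - b| > k |z - a|\<close>.
\<close>

lemma apollonius_identity:
  fixes a b k :: real and z :: complex
  assumes "k\<^sup>2 \<noteq> 1"
  shows "(cmod (z - of_real b))\<^sup>2 - (k * cmod (z - of_real a))\<^sup>2 =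
         (1 - k\<^sup>2) * ((cmod (z - of_real (a - (b - a) / (k\<^sup>2 - 1))))\<^sup>2 -
                     (k * (b - a) / (k\<^sup>2 - 1))\<^sup>2)"
proof -
  define s where "s = (b - a) / (k\<^sup>2 - 1)"
  have b: "b = a + s * (k\<^sup>2 - 1)" using assms by (simp add: s_def)
  have "k * (b - a) / (k\<^sup>2 - 1) = k * s" by (simp add: s_def)
  then show ?thesis
    unfolding s_def[symmetric]
    by (simp only: power_mult_distrib cmod_power2 b)
       (simp add: algebra_simps power2_eq_square)
qed

lemma apollonius_circle_eq_sphere:
  fixes a b k :: real
  assumes "0 < k" "k \<noteq> 1"
  shows "apollonius_circle a b k =
         sphere (of_real (a - (b - a) / (k\<^sup>2 - 1))) (k * \<bar>(b - a) / (k\<^sup>2 - 1)\<bar>)"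
proof -
  have k: "k\<^sup>2 \<noteq> 1" using assms by (simp add: power2_eq_1_iff)
  have "cmod (z - of_real b) = k * cmod (z - of_real a) \<longleftrightarrow>
        cmod (z - of_real (a - (b - a) / (k\<^sup>2 - 1))) = k * \<bar>(b - a) / (k\<^sup>2 - 1)\<bar>" for z
  proof -
    have "cmod (z - of_real b) = k * cmod (z - of_real a) \<longleftrightarrow>
          (cmod (z - of_real b))\<^sup>2 - (k * cmod (z - of_real a))\<^sup>2 = 0"
      using assms by (simp add: power2_eq_iff_nonneg)
    also have "\<dots> \<longleftrightarrow> (cmod (z - of_real (a - (b - a) / (k\<^sup>2 - 1))))\<^sup>2 =
                     (k * \<bar>(b - a) / (k\<^sup>2 - 1)\<bar>)\<^sup>2"
      unfolding apollonius_identity[OF k] using k by (simp add: power_mult_distrib power_divide)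
    also have "\<dots> \<longleftrightarrow> cmod (z - of_real (a - (b - a) / (k\<^sup>2 - 1))) =
                     k * \<bar>(b - a) / (k\<^sup>2 - 1)\<bar>"
      using assms by (intro power2_eq_iff_nonneg) auto
    finally show ?thesis .
  qed
  then show ?thesis
    by (auto simp: apollonius_circle_def sphere_def dist_norm norm_minus_commute)
qed

lemma inside_apollonius_circle:
  fixes a b k :: real
  assumes "a \<noteq> b" "0 < k" "k \<noteq> 1"
  shows "inside (apollonius_circle a b k) =
         ball (of_real (a - (b - a) / (k\<^sup>2 - 1))) (k * \<bar>(b - a) / (k\<^sup>2 - 1)\<bar>)"
    (is "_ = ball ?c ?r")
proof -
  have "k\<^sup>2 \<noteq> 1" using assms by (simp add: power2_eq_1_iff)
  then have "0 < ?r" using assms by simp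
  then have "apollonius_circle a b k = frontier (ball ?c ?r)"
    using apollonius_circle_eq_sphere[OF assms(2,3), of a b] by simp
  then show ?thesis
    by (simp only: inside_frontier_eq_interior[OF bounded_ball convex_ball] interior_ball)
qed

lemma inside_apollonius_circle_gt_1:
  fixes a b k :: real
  assumes "a \<noteq> b" "1 < k"
  shows "inside (apollonius_circle a b k) =
         {z. cmod (z - of_real b) > k * cmod (z - of_real a)}"
proof -
  have k: "1 < k\<^sup>2" using assms by (simp add: one_less_power)
  have "cmod (z - of_real b) > k * cmod (z - of_real a) \<longleftrightarrow>
        cmod (z - of_real (a - (b - a) / (k\<^sup>2 - 1))) < k * \<bar>(b - a) / (k\<^sup>2 - 1)\<bar>" for z
  proof -
    have "cmod (z - of_real b) > k * cmod (z - of_real a) \<longleftrightarrow>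
          (cmod (z - of_real b))\<^sup>2 - (k * cmod (z - of_real a))\<^sup>2 > 0"
      using assms power_mono_iff[of "cmod (z - of_real b)" "k * cmod (z - of_real a)" 2]
      by (auto simp: not_le[symmetric])
    also have "\<dots> \<longleftrightarrow> (cmod (z - of_real (a - (b - a) / (k\<^sup>2 - 1))))\<^sup>2 <
                     (k * \<bar>(b - a) / (k\<^sup>2 - 1)\<bar>)\<^sup>2"
      unfolding apollonius_identity[OF less_imp_neq[OF k, symmetric]]
      using k by (simp add: power_mult_distrib power_divide zero_less_mult_iff)
    also have "\<dots> \<longleftrightarrow> cmod (z - of_real (a - (b - a) / (k\<^sup>2 - 1))) <
                     k * \<bar>(b - a) / (k\<^sup>2 - 1)\<bar>"
      using assms power_mono_iff[of "k * \<bar>(b - a) / (k\<^sup>2 - 1)\<bar>"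
                     "cmod (z - of_real (a - (b - a) / (k\<^sup>2 - 1)))" 2]
      by (auto simp: not_le[symmetric])
    finally show ?thesis .
  qed
  moreover have "inside (apollonius_circle a b k) =
         ball (of_real (a - (b - a) / (k\<^sup>2 - 1))) (k * \<bar>(b - a) / (k\<^sup>2 - 1)\<bar>)"
    using assms by (intro inside_apollonius_circle) auto
  ultimately show ?thesis
    by (auto simp: dist_norm norm_minus_commute)
qed

end

theory Submission
  imports Defs "Berlekamp_Zassenhaus.Factor_Bound"
begin

text \<open>
  A proper factorisation \<open>f = g h\<close> over the integers makes \<open>|g(a)|\<close>, \<open>|g(b)|\<close>, \<open>|h(a)|\<close>, \<open>|h(b)|\<close>
  admissible divisors, because a common divisor of \<open>g(a)\<close> and \<open>h(a)\<close> divides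
  \<open>f'(a) = g'(a) h(a) + g(a) h'(a)\<close>. One of the ratios \<open>|g(b)| / |g(a)|\<close> and \<open>|h(b)| / |h(a)|\<close> is
  at most \<open>sqrt (|f(b)| / |f(a)|)\<close>, hence at most \<open>q\<close>. But such a ratio is the product of
  \<open>|b - z| / |a - z|\<close> over the roots \<open>z\<close> of the factor, and the location of the roots makes every
  term of this product larger than \<open>q\<close>, \<open>sqrt q\<close> or \<open>1\<close>, respectively.
\<close>

text \<open>The values of a factor may be negative at one of the two points. Taking absolute values
  inside the admissible divisors lets the ratio
  \<open>\<bar>poly g b\<bar> / \<bar>poly g a\<bar>\<close> compete in the maximum that defines
  \<open>q\<close>.\<close>

lemma abs_mem_admissible_divisors:
  assumes "d \<in> admissible_divisors f a"
  shows "\<bar>d\<bar> \<in> admissible_divisors f a"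
proof -
  have "poly f a div - d = - (poly f a div d)"
    using assms by (simp add: admissible_divisors_def dvd_neg_div dvd_div_neg)
  then show ?thesis
    using assms by (auto simp: admissible_divisors_def abs_if)
qed

lemma factor_value_mem_admissible_divisors:
  assumes f: "f = g * h" and "poly f a \<noteq> 0"
  shows "poly g a \<in> admissible_divisors f a"
proof -
  have "poly f a div poly g a = poly h a"
    using assms by simp
  moreover have "gcd (poly g a) (poly h a) dvd poly (pderiv f) a"
    by (simp add: f pderiv_mult)
  moreover have "gcd (poly g a) (poly h a) dvd poly f a"
    by (simp add: f)
  ultimately show ?thesis
    by (simp add: admissible_divisors_def f)
qed

text \<open>Induction on the degree, splitting off one linear factor at a time; the leading
  coefficient occurs on both sides and cancels.\<close>

lemma norm_poly_less_of_roots: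
  fixes p :: "complex poly"
  assumes "degree p > 0" and k: "k \<ge> 0"
    and "\<And>z. poly p z = 0 \<Longrightarrow> k * cmod (z - a) < cmod (z - b)"
  shows "k ^ degree p * cmod (poly p a) < cmod (poly p b)"
  using assms(1,3)
proof (induction "degree p" arbitrary: p)
  case 0
  then show ?case by simp
next
  case (Suc n)
  obtain z where z: "poly p z = 0"
    using Suc.prems(1) fundamental_theorem_of_algebra[of p] by (auto simp: constant_degree)
  then obtain r where p: "p = [:-z, 1:] * r"
    by (auto simp: poly_eq_0_iff_dvd elim: dvdE)
  have "r \<noteq> 0" using p Suc.prems(1) by auto
  then have deg: "degree p = Suc (degree r)"
    unfolding p by (subst degree_mult_eq) auto
  have z_less: "k * cmod (a - z) < cmod (b - z)"
    using Suc.prems(2)[OF z] by (simp add: norm_minus_commute)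
  \<comment> \<open>A constant cofactor gives only equality, so a weak inequality is kept for
    \<open>r\<close>. Strictness then comes from the factor of the root \<open>z\<close>, provided
    that \<open>poly r b\<close> is nonzero.\<close>
  have r_le: "k ^ degree r * cmod (poly r a) \<le> cmod (poly r b)"
  and r_pos: "cmod (poly r b) > 0"
  proof -
    have "k ^ degree r * cmod (poly r a) \<le> cmod (poly r b) \<and> cmod (poly r b) > 0"
    proof (cases "degree r = 0")
      case True
      then obtain c where "r = [:c:]" by (rule degree_eq_zeroE)
      then show ?thesis using \<open>r \<noteq> 0\<close> by simp
    next
      case False
      have "k ^ degree r * cmod (poly r a) < cmod (poly r b)"
        using False deg Suc.hyps(2) Suc.prems(2) by (intro Suc.hyps(1)) (auto simp: p)
      moreover have "0 \<le> k ^ degree r * cmod (poly r a)"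
        using k by simp
      ultimately show ?thesis by linarith
    qed
    then show "k ^ degree r * cmod (poly r a) \<le> cmod (poly r b)" "cmod (poly r b) > 0"
      by auto
  qed
  have "k ^ degree p * cmod (poly p a) = (k * cmod (a - z)) * (k ^ degree r * cmod (poly r a))"
    unfolding deg by (simp add: p norm_mult algebra_simps flip: norm_mult)
  also have "\<dots> \<le> (k * cmod (a - z)) * cmod (poly r b)"
    using r_le k by (intro mult_left_mono) auto
  also have "\<dots> < cmod (b - z) * cmod (poly r b)"
    using z_less r_pos by simp
  also have "\<dots> = cmod (poly p b)"
    by (simp add: p algebra_simps flip: norm_mult)
  finally show ?case .
qed

lemma abs_poly_less_of_roots:
  fixes g :: "int poly" and a b :: int and k :: real
  assumes "degree g > 0" "k \<ge> 0"
    and "\<And>z::complex. poly (of_int_poly g) z = 0 \<Longrightarrow> k * cmod (z - of_int a) < cmod (z - of_int b)"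
  shows "k ^ degree g * \<bar>poly g a\<bar> < \<bar>poly g b\<bar>"
proof -
  have "cmod (poly (of_int_poly g) (of_int x)) = \<bar>poly g x\<bar>" for x
    by simp
  then show ?thesis
    using norm_poly_less_of_roots[of "of_int_poly g" k "of_int a" "of_int b"] assms by simp
qed

text \<open>Gauss's lemma: a factorisation over the rationals rescales to one over the integers with
  the same degrees, and nonzero constants are units over the rationals.\<close>

lemma irreducible_rat_if_no_int_factor:
  fixes f :: "int poly"
  assumes "degree f > 0"
    and "\<And>g h. f = g * h \<Longrightarrow> degree g > 0 \<Longrightarrow> degree h > 0 \<Longrightarrow> False"
  shows "irreducible (map_poly rat_of_int f)"
proof (rule irreducibleI)
  show "map_poly rat_of_int f \<noteq> 0" using assms(1) by auto
  show "\<not> map_poly rat_of_int f dvd 1" using assms(1) by (simp add: poly_dvd_1)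
next
  fix G H :: "rat poly"
  assume GH: "map_poly rat_of_int f = G * H"
  then have "G \<noteq> 0" "H \<noteq> 0" using assms(1) by auto
  obtain g h where "f = g * h" "degree g = degree G" "degree h = degree H"
    using rat_to_int_factor[OF GH] by blast
  then have "degree G = 0 \<or> degree H = 0" using assms(2)[of g h] by auto
  then show "G dvd 1 \<or> H dvd 1"
    using \<open>G \<noteq> 0\<close> \<open>H \<noteq> 0\<close> by (auto simp: is_unit_iff_degree)
qed

text \<open>The common core of the three cases, which differ only in how the location of the roots
  yields \<open>ratio\<close>.\<close>

lemma irreducible_if_factor_ratios_gt:
  fixes f :: "int poly" and a b :: int and q :: real
  assumes a: "0 < \<bar>poly f a\<bar>" and ab: "\<bar>poly f a\<bar> < \<bar>poly f b\<bar>"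
    and q: "q = Max {real_of_int d2 / real_of_int d1 | d1 d2.
               d1 \<in> admissible_divisors f a \<and> d2 \<in> admissible_divisors f b \<and>
               real_of_int d2 / real_of_int d1
                 \<le> sqrt (real_of_int \<bar>poly f b\<bar> / real_of_int \<bar>poly f a\<bar>)}"
    and ratio: "\<And>g. g dvd f \<Longrightarrow> degree g > 0 \<Longrightarrow> q * \<bar>poly g a\<bar> < \<bar>poly g b\<bar>"
  shows "irreducible (map_poly rat_of_int f)"
proof (rule irreducible_rat_if_no_int_factor)
  show "degree f > 0"
  proof (rule ccontr)
    assume "\<not> degree f > 0"
    then obtain c where "f = [:c:]" by (auto elim: degree_eq_zeroE)
    then show False using ab by simp
  qed
next
  have fa: "poly f a \<noteq> 0" and fb: "poly f b \<noteq> 0" using a ab by auto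
  define t where "t = sqrt (real_of_int \<bar>poly f b\<bar> / real_of_int \<bar>poly f a\<bar>)"
  \<comment> \<open>There is a gap: a ratio not exceeding \<open>t\<close> would take part in the
    maximum and be at most \<open>q\<close>, against \<open>ratio\<close>.\<close>
  have large: "t < \<bar>poly g b\<bar> / \<bar>poly g a\<bar>" if g: "g dvd f" "degree g > 0" for g
  proof (rule ccontr)
    assume small: "\<not> ?thesis"
    obtain h where f: "f = g * h" using g by blast
    have "poly g a \<noteq> 0" using fa f by auto
    have "\<bar>poly g a\<bar> \<in> admissible_divisors f a" "\<bar>poly g b\<bar> \<in> admissible_divisors f b"
      using factor_value_mem_admissible_divisors[OF f] fa fb
      by (auto intro: abs_mem_admissible_divisors)
    then have "real_of_int \<bar>poly g b\<bar> / real_of_int \<bar>poly g a\<bar> \<le> q"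
      unfolding q using small finite_admissible_quotients[OF fa fb]
      by (intro Max_ge) (blast, unfold t_def not_less, blast)
    then show False
      using ratio[OF g] \<open>poly g a \<noteq> 0\<close> by (simp add: field_simps)
  qed
  fix g h assume f: "f = g * h" and deg: "degree g > 0" "degree h > 0"
  have "t \<ge> 0" by (simp add: t_def)
  \<comment> \<open>Both cofactors exceed \<open>t\<close>, yet their ratios multiply to exactly the
    square of \<open>t\<close>.\<close>
  have "t * t < (\<bar>poly g b\<bar> / \<bar>poly g a\<bar>) * (\<bar>poly h b\<bar> / \<bar>poly h a\<bar>)"
    using large[of g] large[of h] deg f \<open>t \<ge> 0\<close> by (intro mult_strict_mono') auto
  also have "\<dots> = \<bar>poly f b\<bar> / \<bar>poly f a\<bar>"
    by (simp add: f abs_mult)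
  also have "\<dots> = t * t"
    by (simp add: t_def)
  finally show False by simp
qed

text \<open>A linear factor \<open>[:c, d:]\<close> would give \<open>f\<close> the rational root
  \<open>- c / d\<close>.\<close>

lemma two_le_degree_if_no_rat_root:
  fixes f g :: "int poly"
  assumes "\<not> (\<exists>r::rat. poly (of_int_poly f) r = 0)" and "g dvd f" and "degree g > 0"
  shows "2 \<le> degree g"
proof (rule ccontr)
  assume "\<not> 2 \<le> degree g"
  then have "degree (of_int_poly g :: rat poly) = 1" using assms(3) by simp
  then obtain d c where cd: "(of_int_poly g :: rat poly) = [:c, d:]" "d \<noteq> 0"
    by (rule degree1_coeffs)
  obtain h where "f = g * h" using assms(2) by blast
  then have "poly (of_int_poly f) (- c / d) = 0"
    using cd by (simp add: hom_distribs)
  then show False using assms(1) by blast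
qed

theorem theorem1p2:
  fixes f :: "int poly" and a b :: int and q :: real
  assumes "0 < \<bar>poly f a\<bar>" and "\<bar>poly f a\<bar> < \<bar>poly f b\<bar>"
    and "q = Max {real_of_int d2 / real_of_int d1 | d1 d2.
               d1 \<in> admissible_divisors f a \<and> d2 \<in> admissible_divisors f b \<and>
               real_of_int d2 / real_of_int d1
                 \<le> sqrt (real_of_int \<bar>poly f b\<bar> / real_of_int \<bar>poly f a\<bar>)}"
  shows "(q > 1 \<and>
            (\<forall>z::complex. poly (map_poly of_int f) z = 0 \<longrightarrow>
               z \<in> inside (apollonius_circle (real_of_int a) (real_of_int b) q))
          \<longrightarrow> irreducible (map_poly rat_of_int f))
       \<and> (q > 1 \<and>
            (\<forall>z::complex. poly (map_poly of_int f) z = 0 \<longrightarrow>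
               z \<in> inside (apollonius_circle (real_of_int a) (real_of_int b) (sqrt q))) \<and>
            \<not> (\<exists>r::rat. poly (map_poly of_int f) r = 0)
          \<longrightarrow> irreducible (map_poly rat_of_int f))
       \<and> (q = 1 \<and>
            (b > a \<and> (\<forall>z::complex. poly (map_poly of_int f) z = 0 \<longrightarrow>
                         Re z < (real_of_int a + real_of_int b) / 2) \<or>
             a > b \<and> (\<forall>z::complex. poly (map_poly of_int f) z = 0 \<longrightarrow>
                         Re z > (real_of_int a + real_of_int b) / 2))
          \<longrightarrow> irreducible (map_poly rat_of_int f))"
proof (intro conjI impI; (elim conjE)?)
  have "a \<noteq> b" using assms(2) by auto
  have root: "poly (of_int_poly f) z = 0" if "g dvd f" "poly (of_int_poly g) z = 0"
    for g and z :: complex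
    using that by (auto simp: hom_distribs)
  note irr = irreducible_if_factor_ratios_gt[OF assms]
  {
    assume "q > 1" and roots: "\<forall>z::complex. poly (map_poly of_int f) z = 0 \<longrightarrow>
      z \<in> inside (apollonius_circle (real_of_int a) (real_of_int b) q)"
    show "irreducible (map_poly rat_of_int f)"
    proof (rule irr)
      fix g assume g: "g dvd f" "degree g > 0"
      have "q * \<bar>poly g a\<bar> \<le> q ^ degree g * \<bar>poly g a\<bar>"
        using \<open>q > 1\<close> g power_increasing[of 1 "degree g" q] by (intro mult_right_mono) auto
      also have "\<dots> < \<bar>poly g b\<bar>"
        using g \<open>q > 1\<close> roots root[OF g(1)] inside_apollonius_circle_gt_1[of a b q] \<open>a \<noteq> b\<close>
        by (intro abs_poly_less_of_roots) auto
      finally show "q * \<bar>poly g a\<bar> < \<bar>poly g b\<bar>" .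
    qed
  }
  {
    assume "q > 1" and roots: "\<forall>z::complex. poly (map_poly of_int f) z = 0 \<longrightarrow>
      z \<in> inside (apollonius_circle (real_of_int a) (real_of_int b) (sqrt q))"
      and no_root: "\<not> (\<exists>r::rat. poly (map_poly of_int f) r = 0)"
    show "irreducible (map_poly rat_of_int f)"
    proof (rule irr)
      fix g assume g: "g dvd f" "degree g > 0"
      \<comment> \<open>Every root contributes only a factor \<open>sqrt q\<close>, but
        \<open>g\<close> has at least two roots, counted with multiplicity, which restores
        \<open>q\<close>.\<close>
      have "q * \<bar>poly g a\<bar> = sqrt q ^ 2 * \<bar>poly g a\<bar>"
        using \<open>q > 1\<close> by simp
      also have "\<dots> \<le> sqrt q ^ degree g * \<bar>poly g a\<bar>"
        using \<open>q > 1\<close> two_le_degree_if_no_rat_root[OF no_root g]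
        by (intro mult_right_mono power_increasing) auto
      also have "\<dots> < \<bar>poly g b\<bar>"
        using g \<open>q > 1\<close> roots root[OF g(1)] inside_apollonius_circle_gt_1[of a b "sqrt q"] \<open>a \<noteq> b\<close>
        by (intro abs_poly_less_of_roots) auto
      finally show "q * \<bar>poly g a\<bar> < \<bar>poly g b\<bar>" .
    qed
  }
  {
    assume "q = 1" and roots:
      "b > a \<and> (\<forall>z::complex. poly (map_poly of_int f) z = 0 \<longrightarrow>
                   Re z < (real_of_int a + real_of_int b) / 2) \<or>
       a > b \<and> (\<forall>z::complex. poly (map_poly of_int f) z = 0 \<longrightarrow>
                   Re z > (real_of_int a + real_of_int b) / 2)"
    have nearer: "cmod (z - of_int a) < cmod (z - of_int b)"
      if "poly (of_int_poly f) z = 0" for z :: complex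
    proof -
      \<comment> \<open>This product is the difference of the squared distances of \<open>z\<close>
        from \<open>b\<close> and from \<open>a\<close>. Either orientation of the half-plane gives
        its two factors the same sign.\<close>
      have "(real_of_int b - a) * (a + b - 2 * Re z) > 0"
        using roots that by (fastforce simp: zero_less_mult_iff)
      then have "(cmod (z - of_int a))\<^sup>2 < (cmod (z - of_int b))\<^sup>2"
        unfolding cmod_power2 by (simp add: power2_eq_square algebra_simps)
      then show ?thesis
        by (rule power2_less_imp_less) simp
    qed
    show "irreducible (map_poly rat_of_int f)"
    proof (rule irr)
      fix g assume g: "g dvd f" "degree g > 0"
      show "q * \<bar>poly g a\<bar> < \<bar>poly g b\<bar>"
        using abs_poly_less_of_roots[of g 1 a b] g nearer root[OF g(1)] \<open>q = 1\<close> by simp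
    qed
  }
qed

end
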